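(* Every box-integer polyhedron $P \subseteq \mathbb{R}^n$ can be represented as a Minkowski sum $P = Q + C = \{q + c \mid q \in Q,\ c \in C\}$ with a bounded box-integer polyhedron $Q$ and a box-integer polyhedral cone $C$.
   Context: All polyhedra are assumed nonempty. A polyhedron $P$ is an integer polyhedron if $P$ equals the convex hull of $P \cap \mathbb{Z}^n$. A polyhedron $P \subseteq \mathbb{R}^n$ is box-integer if $P \cap \{x \in \mathbb{R}^n \mid l \le x \le u\}$ is an integer polyhedron for every choice of integer vectors $l,u \in \mathbb{Z}^n$ with $l \le u$. A cone is a set $C$ with $\lambda d \in C$ whenever $d \in C$ and $\lambda \ge 0$. *)

theory Defs
  imports "HOL-Analysis.Analysis"
begin

definition int_vectors :: "(real ^ 'n) set" where
  "int_vectors = {x. \<forall>i. x $ i \<in> \<int>}"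

text \<open>Nonemptiness is deliberately not part of this definition: box-integrality applies it to
  intersections of a polyhedron with a box, which may be empty and then impose no condition.\<close>

definition integer_polyhedron :: "(real ^ 'n) set \<Rightarrow> bool" where
  "integer_polyhedron P \<longleftrightarrow> polyhedron P \<and> P = convex hull (P \<inter> int_vectors)"

text \<open>The order on vectors is componentwise, so \<open>{l..u}\<close> is the box between \<open>l\<close> and \<open>u\<close>.
  The standing assumption that polyhedra are nonempty is included here, since the library's
  \<^const>\<open>polyhedron\<close> admits the empty set.\<close>

definition box_integer :: "(real ^ 'n) set \<Rightarrow> bool" where
  "box_integer P \<longleftrightarrow> polyhedron P \<and> P \<noteq> {} \<and>
     (\<forall>l\<in>int_vectors. \<forall>u\<in>int_vectors. l \<le> u \<longrightarrow> integer_polyhedron (P \<inter> {l..u}))"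

end

theory Submission
  imports Defs
begin

text \<open>Take for \<open>C\<close> the recession cone and for \<open>Q\<close> the intersection of \<open>P\<close> with a large integer box;
  intersecting with a box preserves box-integrality. Given an extreme point \<open>x\<close> of
  \<open>C \<inter> {l..u}\<close>, there is a nonempty face \<open>G\<close> of \<open>P\<close> that is invariant under
  translation by \<open>x\<close> and along whose directions \<open>x\<close> can be moved slightly in both
  senses without leaving \<open>C\<close>. Box-integrality yields an integer point \<open>p \<in> G\<close>, and
  extremality of \<open>x\<close> makes \<open>p + x\<close> the only point of \<open>G\<close> in the smallest integer
  box around it. So \<open>p + x\<close>, and with it \<open>x\<close>, is an integer vector.\<close>

section \<open>Systems of linear inequalities and their recession cones\<close>

definition solutions :: "('a::real_inner \<times> real) set \<Rightarrow> 'a set" where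
  "solutions J = {x. \<forall>(a, b)\<in>J. a \<bullet> x \<le> b}"

text \<open>The homogenised system; it describes the recession cone of \<open>solutions J\<close>
  when that set is nonempty. Working with \<open>J\<close> instead of the bare set keeps normals and
  right-hand sides at hand, so that tight constraints can be named and counted.\<close>

definition recession_cone :: "('a::real_inner \<times> real) set \<Rightarrow> 'a set" where
  "recession_cone J = {d. \<forall>(a, b)\<in>J. a \<bullet> d \<le> 0}"

lemma solutionsD: "x \<in> solutions J \<Longrightarrow> (a, b) \<in> J \<Longrightarrow> a \<bullet> x \<le> b"
  by (auto simp: solutions_def)

lemma recession_coneD: "d \<in> recession_cone J \<Longrightarrow> (a, b) \<in> J \<Longrightarrow> a \<bullet> d \<le> 0"
  by (auto simp: recession_cone_def)

lemma polyhedron_imp_solutions: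
  fixes P :: "'a::euclidean_space set"
  assumes "polyhedron P"
  obtains J where "finite J" "P = solutions J"
proof -
  obtain F where F: "finite F" "P = \<Inter>F" "\<And>h. h \<in> F \<Longrightarrow> \<exists>a b. a \<noteq> 0 \<and> h = {x. a \<bullet> x \<le> b}"
    using assms unfolding polyhedron_def by metis
  then obtain A B where AB: "\<And>h. h \<in> F \<Longrightarrow> h = {x. A h \<bullet> x \<le> B h}"
    by metis
  have "P = solutions ((\<lambda>h. (A h, B h)) ` F)"
    unfolding F(2) solutions_def using AB by blast
  with F(1) show thesis by (intro that) auto
qed

lemma polyhedron_solutions:
  fixes J :: "('a::euclidean_space \<times> real) set"
  assumes "finite J"
  shows "polyhedron (solutions J)"
proof -
  have "solutions J = \<Inter>((\<lambda>(a, b). {x. a \<bullet> x \<le> b}) ` J)"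
    by (auto simp: solutions_def)
  then show ?thesis
    using assms by (auto intro!: polyhedron_Inter polyhedron_halfspace_le)
qed

lemma recession_cone_eq_solutions:
  "recession_cone J = solutions ((\<lambda>(a, b). (a, 0)) ` J)"
  by (auto simp: recession_cone_def solutions_def)

lemma polyhedron_recession_cone:
  fixes J :: "('a::euclidean_space \<times> real) set"
  shows "finite J \<Longrightarrow> polyhedron (recession_cone J)"
  by (simp add: recession_cone_eq_solutions polyhedron_solutions)

lemma cone_recession_cone: "cone (recession_cone J)"
  by (fastforce simp: cone_def recession_cone_def mult_nonneg_nonpos)

lemma zero_in_recession_cone: "0 \<in> recession_cone J"
  by (auto simp: recession_cone_def)

lemma recession_cone_add:
  "c \<in> recession_cone J \<Longrightarrow> d \<in> recession_cone J \<Longrightarrow> c + d \<in> recession_cone J"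
  by (fastforce simp: recession_cone_def inner_add_right)

lemma solutions_add_recession_cone:
  "x \<in> solutions J \<Longrightarrow> d \<in> recession_cone J \<Longrightarrow> x + d \<in> solutions J"
  by (fastforce simp: recession_cone_def solutions_def inner_add_right)

section \<open>Bounded representatives modulo the recession cone\<close>

text \<open>Otherwise, least-norm points \<open>q n\<close> of \<open>P \<inter> (y n - C)\<close> are unbounded; after normalisation
  they accumulate at a direction \<open>d \<in> C\<close>, and \<open>q n - d\<close> is eventually a shorter choice.\<close>

lemma solutions_bounded_decomposition:
  fixes J :: "('a::euclidean_space \<times> real) set"
  assumes fin: "finite J"
  obtains R where "\<And>y. y \<in> solutions J \<Longrightarrow>
    \<exists>q\<in>solutions J. norm q \<le> R \<and> y - q \<in> recession_cone J"
proof (rule ccontr)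
  assume "\<not> thesis"
  then have "\<exists>y\<in>solutions J. \<forall>q\<in>solutions J. y - q \<in> recession_cone J \<longrightarrow> norm q > R" for R
    using that by (meson not_le)
  then have "\<forall>n::nat. \<exists>y. y \<in> solutions J \<and>
      (\<forall>q\<in>solutions J. y - q \<in> recession_cone J \<longrightarrow> norm q > real n)"
    by blast
  from choice[OF this] obtain y where y: "\<And>n::nat. y n \<in> solutions J"
    and yR: "\<And>n q. q \<in> solutions J \<Longrightarrow> y n - q \<in> recession_cone J \<Longrightarrow> norm q > real n"
    by blast
  define S where "S n = {q \<in> solutions J. y n - q \<in> recession_cone J}" for n
  have "closed (S n)" for n
  proof -
    have "closed (solutions J)" "closed (recession_cone J)"
      using fin by (auto intro: polyhedron_imp_closed polyhedron_solutions polyhedron_recession_cone)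
    moreover have "S n = solutions J \<inter> (\<lambda>q. y n - q) -` recession_cone J"
      by (auto simp: S_def)
    ultimately show ?thesis
      by (auto intro!: closed_Int closed_vimage continuous_intros)
  qed
  moreover have "S n \<noteq> {}" for n
    using y[of n] by (auto simp: S_def zero_in_recession_cone intro!: exI[of _ "y n"])
  ultimately have "\<exists>q\<in>S n. \<forall>z\<in>S n. norm q \<le> norm z" for n
    using distance_attains_inf[of "S n" 0] by (metis dist_0_norm)
  then obtain q where qS: "\<And>n. q n \<in> S n" and qmin: "\<And>n z. z \<in> S n \<Longrightarrow> norm (q n) \<le> norm z"
    by metis
  have qbig: "norm (q n) > real n" for n
    using yR[of "q n" n] qS[of n] by (auto simp: S_def)
  then have qpos: "norm (q n) > 0" for n
    by (metis le_less_trans of_nat_0_le_iff)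
  define e where "e n = q n /\<^sub>R norm (q n)" for n
  have "e n \<in> sphere 0 1" for n
    using qpos[of n] by (auto simp: e_def)
  then obtain d r where d: "d \<in> sphere 0 1" and r: "strict_mono r" and lim: "(e \<circ> r) \<longlonglongrightarrow> d"
    using compact_sphere[of "0::'a" 1] unfolding compact_def by metis
  have norm_lim: "filterlim (\<lambda>n. norm (q (r n))) at_top sequentially"
  proof (rule filterlim_at_top_mono[OF filterlim_real_sequentially], rule always_eventually, rule allI)
    fix n show "real n \<le> norm (q (r n))"
      using qbig[of "r n"] seq_suble[OF r, of n] by linarith
  qed
  have q_inner: "a \<bullet> q n = norm (q n) * (a \<bullet> e n)" for a n
    using qpos[of n] by (simp add: e_def)
  have e_inner: "(\<lambda>n. a \<bullet> e (r n)) \<longlonglongrightarrow> a \<bullet> d" for a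
    using tendsto_inner[OF tendsto_const lim] by (simp add: o_def)
  \<comment> \<open>Dividing a constraint on \<open>q n\<close> by \<open>norm (q n)\<close> sends
    its right-hand side to 0, which leaves the homogeneous constraint for the limit
    \<open>d\<close>.\<close>
  have dC: "d \<in> recession_cone J"
    unfolding recession_cone_def
  proof (clarify)
    fix a b assume ab: "(a, b) \<in> J"
    have "(\<lambda>n. b / norm (q (r n))) \<longlonglongrightarrow> 0"
      using norm_lim by (intro tendsto_divide_0[OF tendsto_const] filterlim_at_top_imp_at_infinity)
    moreover have "a \<bullet> e n \<le> b / norm (q n)" for n
      using solutionsD[OF _ ab, of "q n"] qS[of n] qpos[of n]
      by (simp add: S_def q_inner pos_le_divide_eq mult.commute)
    ultimately show "a \<bullet> d \<le> 0"
      by (intro LIMSEQ_le[OF e_inner]) auto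
  qed
  \<comment> \<open>A row orthogonal to \<open>d\<close> does not notice the subtraction of
    \<open>d\<close>. On any other row \<open>a \<bullet> d < 0\<close>, so
    \<open>a \<bullet> q (r n)\<close> tends to minus infinity and the slack eventually absorbs the
    constant \<open>a \<bullet> d\<close>.\<close>
  have feasible: "\<forall>\<^sub>F n in sequentially. a \<bullet> (q (r n) - d) \<le> b" if ab: "(a, b) \<in> J" for a b
  proof (cases "a \<bullet> d = 0")
    case True
    then show ?thesis
      using solutionsD[OF _ ab] qS by (auto simp: S_def inner_diff_right)
  next
    case False
    then have "a \<bullet> d < 0" using recession_coneD[OF dC ab] by simp
    then have "filterlim (\<lambda>n. (a \<bullet> e (r n)) * norm (q (r n))) at_bot sequentially"
      by (intro filterlim_tendsto_neg_mult_at_bot[OF e_inner _ norm_lim])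
    then have "\<forall>\<^sub>F n in sequentially. (a \<bullet> e (r n)) * norm (q (r n)) \<le> b + a \<bullet> d"
      by (simp add: filterlim_at_bot)
    then show ?thesis
      by eventually_elim (simp add: inner_diff_right q_inner mult.commute)
  qed
  have "\<forall>\<^sub>F n in sequentially. \<forall>j\<in>J. fst j \<bullet> (q (r n) - d) \<le> snd j"
    using fin feasible by (intro eventually_ball_finite) auto
  \<comment> \<open>Since \<open>norm d = 1\<close>, the squared norm changes by
    \<open>1 - 2 * (d \<bullet> q)\<close> when \<open>d\<close> is subtracted from
    \<open>q\<close>; the bound 1 makes this negative.\<close>
  moreover have "\<forall>\<^sub>F n in sequentially. d \<bullet> q (r n) \<ge> 1"
  proof -
    have "d \<bullet> d > 0" using d by auto
    then have "filterlim (\<lambda>n. (d \<bullet> e (r n)) * norm (q (r n))) at_top sequentially"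
      by (intro filterlim_tendsto_pos_mult_at_top[OF e_inner _ norm_lim])
    then show ?thesis
      by (simp add: filterlim_at_top q_inner mult.commute)
  qed
  ultimately obtain n where n: "\<forall>j\<in>J. fst j \<bullet> (q (r n) - d) \<le> snd j" "d \<bullet> q (r n) \<ge> 1"
    using eventually_happens'[OF sequentially_bot eventually_conj] by blast
  have "q (r n) - d \<in> solutions J"
    using n(1) by (auto simp: solutions_def)
  moreover have "y (r n) - (q (r n) - d) \<in> recession_cone J"
    using recession_cone_add[OF _ dC, of "y (r n) - q (r n)"] qS[of "r n"]
    by (simp add: S_def algebra_simps)
  ultimately have "norm (q (r n)) \<le> norm (q (r n) - d)"
    by (intro qmin) (auto simp: S_def)
  moreover have "(norm (q (r n) - d))\<^sup>2 < (norm (q (r n)))\<^sup>2"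
  proof -
    have "d \<bullet> d = 1" using d by (simp add: dot_square_norm)
    then show ?thesis
      using n(2) by (simp add: power2_norm_eq_inner inner_diff_left inner_diff_right inner_commute)
  qed
  ultimately show False
    by (meson norm_ge_zero not_le power_mono)
qed

section \<open>Faces cut out by tight constraints\<close>

text \<open>Each constraint gives a supporting hyperplane, and intersections of faces are faces, so
  the constraints of \<open>T\<close> can be added one at a time.\<close>

lemma face_of_solutions_tight:
  fixes J :: "('a::euclidean_space \<times> real) set"
  assumes "finite J" "T \<subseteq> J"
  shows "{y \<in> solutions J. \<forall>(a, b)\<in>T. a \<bullet> y = b} face_of solutions J"
  using finite_subset[OF assms(2,1)] assms(2)
proof (induction T rule: finite_induct)
  case empty
  then show ?case
    using assms(1) by (simp add: face_of_refl polyhedron_imp_convex polyhedron_solutions)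
next
  case (insert j T)
  obtain a b where j: "j = (a, b)" by fastforce
  have "solutions J \<inter> {y. a \<bullet> y = b} face_of solutions J"
    using insert.prems assms(1)
    by (intro face_of_Int_supporting_hyperplane_le)
      (auto simp: j solutionsD polyhedron_imp_convex polyhedron_solutions)
  moreover have "{y \<in> solutions J. \<forall>(a, b)\<in>insert j T. a \<bullet> y = b} =
      {y \<in> solutions J. \<forall>(a, b)\<in>T. a \<bullet> y = b} \<inter> (solutions J \<inter> {y. a \<bullet> y = b})"
    by (auto simp: j)
  ultimately show ?case
    using insert by (simp add: face_of_Int)
qed

text \<open>Choose \<open>g \<in> P\<close> with as many constraints as possible tight among those orthogonal to \<open>x\<close>. If
  one of these constraints were still non-constant on the resulting face, one could move within the
  face until another one becomes tight; a large multiple of \<open>x\<close> keeps the remaining constraints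
  satisfied on the way.\<close>

lemma exists_face_parallel_to_recession_direction:
  fixes J :: "('a::euclidean_space \<times> real) set"
  assumes fin: "finite J" and ne: "solutions J \<noteq> {}" and x: "x \<in> recession_cone J"
  obtains G where "G face_of solutions J" "G \<noteq> {}" "\<And>p. p \<in> G \<Longrightarrow> p + x \<in> G"
    "\<And>p q a b. p \<in> G \<Longrightarrow> q \<in> G \<Longrightarrow> (a, b) \<in> J \<Longrightarrow> a \<bullet> x = 0 \<Longrightarrow> a \<bullet> p = a \<bullet> q"
proof -
  define T where "T g = {(a, b) \<in> J. a \<bullet> x = 0 \<and> a \<bullet> g = b}" for g
  have TJ: "T g \<subseteq> J" for g by (auto simp: T_def)
  have finT: "finite (T g)" for g using finite_subset[OF TJ fin] .
  obtain g0 where "g0 \<in> solutions J" using ne by auto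
  moreover have "\<forall>g. g \<in> solutions J \<longrightarrow> card (T g) < Suc (card J)"
    by (simp add: TJ card_mono fin less_Suc_eq_le)
  ultimately obtain g where g: "g \<in> solutions J"
    and gmax: "\<And>h. h \<in> solutions J \<Longrightarrow> card (T h) \<le> card (T g)"
    using ex_has_greatest_nat[of "\<lambda>g. g \<in> solutions J" g0 "\<lambda>g. card (T g)" "Suc (card J)"] by auto
  \<comment> \<open>The one-sided bound suffices: applied to the differences \<open>p - q\<close>
    and \<open>q - p\<close> of two points of the face, it yields equality.\<close>
  have key: "a \<bullet> v \<le> 0"
    if v: "\<And>a b. (a, b) \<in> T g \<Longrightarrow> a \<bullet> v = 0" and ab: "(a, b) \<in> J" "a \<bullet> x = 0" for v a b
  proof (rule ccontr)
    assume "\<not> a \<bullet> v \<le> 0"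
    \<comment> \<open>A ratio test: \<open>K\<close> collects the rows orthogonal to
      \<open>x\<close> that increase along \<open>v\<close>, and \<open>t\<close> is the largest
      step that none of them forbids.\<close>
    define K where "K = {(a, b) \<in> J. a \<bullet> x = 0 \<and> a \<bullet> v > 0}"
    define \<rho> where "\<rho> = (\<lambda>(a, b). (b - a \<bullet> g) / (a \<bullet> v))"
    define t where "t = Min (\<rho> ` K)"
    have K: "finite K" "K \<noteq> {}"
      using fin ab \<open>\<not> a \<bullet> v \<le> 0\<close> finite_subset[of K J] by (auto simp: K_def)
    have "t \<in> \<rho> ` K" unfolding t_def using K by (intro Min_in) auto
    then obtain k l where kl: "(k, l) \<in> K" and t: "t = (l - k \<bullet> g) / (k \<bullet> v)"
      by (auto simp: \<rho>_def)
    have t0: "t \<ge> 0"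
      using kl solutionsD[OF g, of k l] by (auto simp: t K_def)
    have tle: "t * (a \<bullet> v) \<le> b - a \<bullet> g" if "(a, b) \<in> K" for a b
    proof -
      have "t \<le> \<rho> (a, b)" unfolding t_def using K that by (intro Min_le) auto
      then show ?thesis using that by (auto simp: \<rho>_def K_def pos_le_divide_eq)
    qed
    \<comment> \<open>The remaining rows decrease strictly along \<open>x\<close>, so a large
      \<open>s\<close> offsets the step \<open>t\<close> along \<open>v\<close>; rows orthogonal to
      \<open>x\<close> do not depend on \<open>s\<close>.\<close>
    have "\<forall>\<^sub>F s in at_top. a \<bullet> x < 0 \<longrightarrow> a \<bullet> g + s * (a \<bullet> x) + t * (a \<bullet> v) \<le> b" for a b
    proof (cases "a \<bullet> x < 0")
      case True
      show ?thesis
        using eventually_ge_at_top[of "(b - a \<bullet> g - t * (a \<bullet> v)) / (a \<bullet> x)"]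
        by eventually_elim (use True in \<open>auto simp: neg_divide_le_eq algebra_simps\<close>)
    qed auto
    then have "\<forall>\<^sub>F s in at_top. \<forall>j\<in>J. fst j \<bullet> x < 0 \<longrightarrow>
        fst j \<bullet> g + s * (fst j \<bullet> x) + t * (fst j \<bullet> v) \<le> snd j"
      by (intro eventually_ball_finite fin) auto
    then obtain s where s: "\<And>a b. (a, b) \<in> J \<Longrightarrow> a \<bullet> x < 0 \<Longrightarrow>
        a \<bullet> g + s * (a \<bullet> x) + t * (a \<bullet> v) \<le> b"
      by (auto simp: eventually_at_top_linorder) fastforce
    define g' where "g' = g + s *\<^sub>R x + t *\<^sub>R v"
    have g'_inner: "c \<bullet> g' = c \<bullet> g + s * (c \<bullet> x) + t * (c \<bullet> v)" for c
      by (simp add: g'_def inner_add_right)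
    have "c \<bullet> g' \<le> d" if cd: "(c, d) \<in> J" for c d
    proof (cases "c \<bullet> x = 0")
      case True
      show ?thesis
      proof (cases "c \<bullet> v > 0")
        case True
        then show ?thesis using tle[of c d] \<open>c \<bullet> x = 0\<close> cd by (simp add: K_def g'_inner)
      next
        case False
        then have "t * (c \<bullet> v) \<le> 0" using t0 by (simp add: mult_nonneg_nonpos)
        then show ?thesis using solutionsD[OF g cd] True by (simp add: g'_inner)
      qed
    next
      case False
      then show ?thesis using recession_coneD[OF x cd] s[OF cd] by (simp add: g'_inner)
    qed
    then have "g' \<in> solutions J" by (auto simp: solutions_def)
    \<comment> \<open>The row attaining the minimum becomes tight at \<open>g'\<close>. It was not
      tight at \<open>g\<close>, because \<open>v\<close> is orthogonal to the normals in
      \<open>T g\<close> while \<open>k \<bullet> v > 0\<close>.\<close>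
    moreover have "(k, l) \<in> T g' - T g"
      using kl v[of k l] by (auto simp: T_def K_def g'_inner t)
    moreover have "T g \<subseteq> T g'"
      using v by (auto simp: T_def g'_inner)
    ultimately show False
      using gmax[of g'] psubset_card_mono[OF finT, of "T g" g'] by (metis Diff_iff not_le psubsetI)
  qed
  define G where "G = {y \<in> solutions J. \<forall>(a, b)\<in>T g. a \<bullet> y = b}"
  show thesis
  proof (rule that[of G])
    show "G face_of solutions J"
      unfolding G_def by (intro face_of_solutions_tight fin TJ)
    show "G \<noteq> {}" using g by (auto simp: G_def T_def)
    show "p + x \<in> G" if "p \<in> G" for p
      using that solutions_add_recession_cone[OF _ x] by (auto simp: G_def T_def inner_add_right)
    fix p q a b assume pq: "p \<in> G" "q \<in> G" and ab: "(a, b) \<in> J" "a \<bullet> x = 0"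
    have "a \<bullet> (p - q) \<le> 0" "a \<bullet> (q - p) \<le> 0"
      by (rule key[OF _ ab]; use pq in \<open>auto simp: G_def inner_diff_right\<close>)+
    then show "a \<bullet> p = a \<bullet> q" by (simp add: inner_diff_right)
  qed
qed

section \<open>Extreme points and integer points of box-integer polyhedra\<close>

lemma extreme_point_integer_polyhedron:
  assumes "integer_polyhedron S" "x extreme_point_of S"
  shows "x \<in> int_vectors"
proof -
  have "x extreme_point_of (convex hull (S \<inter> int_vectors))"
    using assms by (simp add: integer_polyhedron_def)
  then show ?thesis
    using extreme_point_of_convex_hull by blast
qed

lemma polyhedron_Icc: "polyhedron {l..u :: real ^ 'n}"
  by (metis interval_cbox_cart polytope_imp_polyhedron polytope_interval)

text \<open>Two integer boxes meet in a box whose corners, a componentwise maximum and minimum, are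
  again integral.\<close>

lemma box_integer_Int_box:
  assumes "box_integer P" "P \<inter> {l..u} \<noteq> {}" "l \<in> int_vectors" "u \<in> int_vectors"
  shows "box_integer (P \<inter> {l..u})"
  unfolding box_integer_def
proof (intro conjI ballI impI)
  show "polyhedron (P \<inter> {l..u})"
    using assms(1) by (auto simp: box_integer_def intro: polyhedron_Int polyhedron_Icc)
  fix l' u' :: "real ^ 'a" assume *: "l' \<in> int_vectors" "u' \<in> int_vectors" "l' \<le> u'"
  define l2 :: "real ^ 'a" where "l2 = (\<chi> i. max (l $ i) (l' $ i))"
  define u2 :: "real ^ 'a" where "u2 = (\<chi> i. min (u $ i) (u' $ i))"
  have eq: "P \<inter> {l..u} \<inter> {l'..u'} = P \<inter> {l2..u2}"
    by (auto simp: less_eq_vec_def l2_def u2_def)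
  have "l2 \<in> int_vectors" "u2 \<in> int_vectors"
    using assms * by (auto simp: int_vectors_def l2_def u2_def max_def min_def)
  \<comment> \<open>If \<open>l2 \<le> u2\<close> fails, the box is empty, and the empty set
    satisfies \<open>integer_polyhedron\<close>.\<close>
  then show "integer_polyhedron (P \<inter> {l..u} \<inter> {l'..u'})"
    unfolding eq using assms(1)
    by (cases "l2 \<le> u2") (auto simp: box_integer_def integer_polyhedron_def)
qed (use assms in auto)

lemma mem_int_vectors_floor_ceiling:
  "(\<chi> i. of_int \<lfloor>y $ i\<rfloor>) \<in> int_vectors" "(\<chi> i. of_int \<lceil>y $ i\<rceil>) \<in> int_vectors"
  by (auto simp: int_vectors_def)

text \<open>\<open>G\<close> itself may have no extreme points, but cut with an integer box around
  \<open>g\<close> it is compact and has one. This point is also extreme in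
  \<open>P \<inter> B\<close>, hence integral.\<close>

lemma box_integer_face_int_vector:
  fixes P :: "(real ^ 'n) set"
  assumes P: "box_integer P" and G: "G face_of P" "g \<in> G"
  obtains p where "p \<in> G" "p \<in> int_vectors"
proof -
  define B :: "(real ^ 'n) set" where "B = {(\<chi> i. of_int \<lfloor>g $ i\<rfloor>)..(\<chi> i. of_int \<lceil>g $ i\<rceil>)}"
  have gB: "g \<in> B" by (auto simp: B_def less_eq_vec_def)
  have "integer_polyhedron (P \<inter> B)"
    using P mem_int_vectors_floor_ceiling[of g] gB unfolding box_integer_def B_def by auto
  moreover have "convex B" by (simp add: B_def interval_cbox_cart[symmetric])
  then have GB: "G \<inter> B face_of P \<inter> B"
    by (intro face_of_Int_Int) (auto simp: G face_of_refl)
  moreover have "compact (G \<inter> B)" "convex (G \<inter> B)"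
  proof -
    have "closed G" using G P by (meson box_integer_def face_of_polyhedron_polyhedron polyhedron_imp_closed)
    moreover have "compact B" by (simp add: B_def interval_cbox_cart[symmetric])
    ultimately show "compact (G \<inter> B)" by (simp add: closed_Int_compact)
    show "convex (G \<inter> B)" using GB face_of_imp_convex by blast
  qed
  then obtain p where p: "p extreme_point_of (G \<inter> B)"
    using extreme_point_exists_convex[of "G \<inter> B"] gB G(2) by auto
  ultimately have "p extreme_point_of (P \<inter> B)"
    using extreme_point_of_face by blast
  then show thesis
    using p extreme_point_integer_polyhedron[OF \<open>integer_polyhedron (P \<inter> B)\<close>] that
    by (auto simp: extreme_point_of_def)
qed

section \<open>Box-integrality of the recession cone\<close>

lemma extreme_point_recession_cone_Int_box:
  fixes J :: "((real ^ 'n) \<times> real) set"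
  assumes fin: "finite J" and P: "box_integer (solutions J)"
    and lu: "l \<in> int_vectors" "u \<in> int_vectors"
    and ext: "x extreme_point_of (recession_cone J \<inter> {l..u})"
  shows "x \<in> int_vectors"
proof -
  have x: "x \<in> recession_cone J" "l \<le> x" "x \<le> u"
    using ext by (auto simp: extreme_point_of_def)
  obtain G where G: "G face_of solutions J" "G \<noteq> {}" "\<And>p. p \<in> G \<Longrightarrow> p + x \<in> G"
    and par: "\<And>p q a b. p \<in> G \<Longrightarrow> q \<in> G \<Longrightarrow> (a, b) \<in> J \<Longrightarrow> a \<bullet> x = 0 \<Longrightarrow> a \<bullet> p = a \<bullet> q"
    using exists_face_parallel_to_recession_direction[OF fin _ x(1)] P
    unfolding box_integer_def by metis
  obtain p where p: "p \<in> G" "p \<in> int_vectors"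
    using box_integer_face_int_vector[OF P G(1)] G(2) by blast
  define l' :: "real ^ 'n" where "l' = (\<chi> i. of_int \<lfloor>(p + x) $ i\<rfloor>)"
  define u' :: "real ^ 'n" where "u' = (\<chi> i. of_int \<lceil>(p + x) $ i\<rceil>)"
  have lu': "l' \<in> int_vectors" "u' \<in> int_vectors" "l' \<le> p + x" "p + x \<le> u'"
    by (auto simp: l'_def u'_def less_eq_vec_def mem_int_vectors_floor_ceiling(1)[of "p + x", simplified]
        mem_int_vectors_floor_ceiling(2)[of "p + x", simplified])
  have uniq: "y = p + x" if y: "y \<in> G" "y \<in> {l'..u'}" for y
  proof (rule ccontr)
    assume neq: "y \<noteq> p + x"
    define v where "v = y - (p + x)"
    have v0: "v \<noteq> 0" using neq by (simp add: v_def)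
    \<comment> \<open>As \<open>p\<close> is integral, an integral coordinate of \<open>x\<close>
      stays integral in \<open>p + x\<close>, and there the box \<open>{l'..u'}\<close> has width
      0.\<close>
    have v_coord: "v $ i = 0" if "x $ i \<in> \<int>" for i
    proof -
      have "(p + x) $ i \<in> \<int>" using that p(2) by (auto simp: int_vectors_def)
      then have "l' $ i = (p + x) $ i" "u' $ i = (p + x) $ i"
        by (auto simp: l'_def u'_def elim!: Ints_cases)
      moreover have "l' $ i \<le> y $ i" "y $ i \<le> u' $ i" using y by (auto simp: less_eq_vec_def)
      ultimately show ?thesis by (simp add: v_def)
    qed
    have small: "\<forall>\<^sub>F e in at_right 0. a + e * c \<le> b" if "a < b \<or> a = b \<and> c = 0" for a b c :: real
    proof (cases "a = b")
      case False
      then have "a < b" using that by auto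
      moreover have "((\<lambda>e. a + e * c) \<longlongrightarrow> a + 0 * c) (at_right 0)"
        by (intro tendsto_intros)
      ultimately have "\<forall>\<^sub>F e in at_right 0. a + e * c < b"
        by (intro order_tendstoD(2)) auto
      then show ?thesis by eventually_elim simp
    qed (use that in auto)
    \<comment> \<open>Slack constraints tolerate a small step. A tight row of the cone is constant
      on \<open>G\<close>, which contains both \<open>y\<close> and \<open>p + x\<close>; a tight
      bound makes \<open>x $ i\<close> integral, so \<open>v $ i = 0\<close>. Both signs of
      \<open>v\<close> are needed to make \<open>x\<close> a midpoint.\<close>
    have move: "\<forall>\<^sub>F e in at_right 0. x + e *\<^sub>R w \<in> recession_cone J \<inter> {l..u}"
      if w: "w = v \<or> w = - v" for w
    proof -
      have "\<forall>\<^sub>F e in at_right 0. \<forall>j\<in>J. fst j \<bullet> x + e * (fst j \<bullet> w) \<le> 0"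
      proof (intro eventually_ball_finite fin ballI small)
        fix j assume j: "j \<in> J"
        then show "fst j \<bullet> x < 0 \<or> fst j \<bullet> x = 0 \<and> fst j \<bullet> w = 0"
          using recession_coneD[OF x(1), of "fst j" "snd j"] par[OF y(1) G(3)[OF p(1)], of "fst j" "snd j"] w
          by (auto simp: v_def inner_diff_right)
      qed
      moreover have "\<forall>\<^sub>F e in at_right 0. \<forall>i\<in>UNIV. x $ i + e * (w $ i) \<le> u $ i"
      proof (intro eventually_ball_finite ballI small)
        fix i
        show "x $ i < u $ i \<or> x $ i = u $ i \<and> w $ i = 0"
          using x(3) lu(2) v_coord[of i] w by (auto simp: less_eq_vec_def int_vectors_def less_le)
      qed auto
      \<comment> \<open>Lower bounds are negated to fit the upper-bound form of
        \<open>small\<close>.\<close>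
      moreover have "\<forall>\<^sub>F e in at_right 0. \<forall>i\<in>UNIV. - x $ i + e * (- w $ i) \<le> - l $ i"
      proof (intro eventually_ball_finite ballI small)
        fix i
        show "- x $ i < - l $ i \<or> - x $ i = - l $ i \<and> - w $ i = 0"
          using x(2) lu(1) v_coord[of i] w by (auto simp: less_eq_vec_def int_vectors_def less_le)
      qed auto
      ultimately show ?thesis
      proof eventually_elim
        case (elim e)
        have "x + e *\<^sub>R w \<in> recession_cone J"
          using elim(1) by (auto simp: recession_cone_def inner_add_right)
        moreover have "x + e *\<^sub>R w \<le> u" using elim(2) by (simp add: less_eq_vec_def)
        moreover have "l \<le> x + e *\<^sub>R w" using elim(3) by (auto simp: less_eq_vec_def algebra_simps)
        ultimately show ?case by simp
      qed
    qed
    have "\<forall>\<^sub>F e in at_right 0. e > (0::real) \<and> x + e *\<^sub>R v \<in> recession_cone J \<inter> {l..u} \<and>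
        x + e *\<^sub>R (- v) \<in> recession_cone J \<inter> {l..u}"
      by (intro eventually_conj move eventually_at_right_less) auto
    then obtain e where e: "e > (0::real)" "x + e *\<^sub>R v \<in> recession_cone J \<inter> {l..u}"
        "x + e *\<^sub>R (- v) \<in> recession_cone J \<inter> {l..u}"
      using eventually_happens'[OF trivial_limit_at_right_real] by blast
    have "x = midpoint (x + e *\<^sub>R v) (x + e *\<^sub>R (- v))"
      by (simp add: midpoint_eq_iff eq_commute[of x])
    moreover have "x + e *\<^sub>R v \<noteq> x + e *\<^sub>R (- v)"
      using e(1) v0 by (auto simp: vec_eq_iff)
    ultimately have "x \<in> open_segment (x + e *\<^sub>R v) (x + e *\<^sub>R (- v))"
      by (metis midpoint_in_open_segment)
    then show False
      using ext e(2,3) by (auto simp: extreme_point_of_def)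
  qed
  have "integer_polyhedron (solutions J \<inter> {l'..u'})"
    using P lu' order_trans unfolding box_integer_def by blast
  moreover have "G \<inter> {l'..u'} face_of solutions J \<inter> {l'..u'}"
    by (intro face_of_Int_Int) (auto simp: G face_of_refl interval_cbox_cart[symmetric])
  \<comment> \<open>A singleton face is an extreme point, here of an integer polyhedron.\<close>
  moreover have "G \<inter> {l'..u'} = {p + x}"
  proof
    show "{p + x} \<subseteq> G \<inter> {l'..u'}" using lu'(3,4) G(3)[OF p(1)] by simp
  qed (use uniq in blast)
  ultimately have "p + x \<in> int_vectors"
    by (metis extreme_point_integer_polyhedron face_of_singleton)
  then have "p $ i + x $ i - p $ i \<in> \<int>" for i
    using p(2) unfolding int_vectors_def by (metis (mono_tags) Ints_diff mem_Collect_eq vector_add_component)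
  then show ?thesis
    by (simp add: int_vectors_def)
qed

text \<open>Within a box the cone becomes compact, so it is the hull of its extreme points, all of
  which are integral.\<close>

lemma box_integer_recession_cone:
  fixes J :: "((real ^ 'n) \<times> real) set"
  assumes "finite J" "box_integer (solutions J)"
  shows "box_integer (recession_cone J)"
  unfolding box_integer_def
proof (intro conjI ballI impI)
  show "polyhedron (recession_cone J)" by (rule polyhedron_recession_cone[OF assms(1)])
  show "recession_cone J \<noteq> {}" using zero_in_recession_cone by blast
  fix l u :: "real ^ 'n" assume lu: "l \<in> int_vectors" "u \<in> int_vectors" "l \<le> u"
  define S where "S = recession_cone J \<inter> {l..u}"
  have poly: "polyhedron S"
    unfolding S_def by (intro polyhedron_Int polyhedron_recession_cone polyhedron_Icc assms)
  have "bounded S"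
    unfolding S_def by (simp add: bounded_Int interval_cbox_cart[symmetric])
  then have "compact S" "convex S"
    using poly by (auto simp: compact_eq_bounded_closed polyhedron_imp_closed polyhedron_imp_convex)
  then have "S = convex hull {x. x extreme_point_of S}"
    by (rule Krein_Milman_Minkowski)
  also have "\<dots> \<subseteq> convex hull (S \<inter> int_vectors)"
    using extreme_point_recession_cone_Int_box[OF assms lu(1,2)]
    by (intro hull_mono) (auto simp: S_def extreme_point_of_def)
  finally have "S = convex hull (S \<inter> int_vectors)"
    using \<open>convex S\<close> by (metis Int_lower1 hull_minimal subset_antisym)
  then show "integer_polyhedron (recession_cone J \<inter> {l..u})"
    using poly by (simp add: integer_polyhedron_def S_def)
qed

section \<open>Assembling the Minkowski decomposition\<close>

theorem theorem3p3:
  fixes P :: "(real ^ 'n) set"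
  assumes "box_integer P"
  shows "\<exists>Q C. box_integer Q \<and> bounded Q \<and> box_integer C \<and> cone C \<and>
           P = {q + c | q c. q \<in> Q \<and> c \<in> C}"
proof -
  have "polyhedron P" using assms by (simp add: box_integer_def)
  then obtain J where J: "finite J" "P = solutions J" by (rule polyhedron_imp_solutions)
  obtain R where R: "\<And>y. y \<in> P \<Longrightarrow> \<exists>q\<in>P. norm q \<le> R \<and> y - q \<in> recession_cone J"
    using solutions_bounded_decomposition[OF J(1)] unfolding J(2) by metis
  \<comment> \<open>Rounding \<open>R\<close> up gives the box integral corners, and it still
    contains the ball of radius \<open>R\<close> because coordinates are bounded by the
    norm.\<close>
  define u :: "real ^ 'n" where "u = (\<chi> i. of_int \<lceil>R\<rceil>)"
  define Q where "Q = P \<inter> {-u..u}"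
  have in_box: "q \<in> {-u..u}" if "norm q \<le> R" for q
  proof -
    have "\<bar>q $ i\<bar> \<le> of_int \<lceil>R\<rceil>" for i
      using component_le_norm_cart[of q i] that by linarith
    then show ?thesis by (auto simp: u_def less_eq_vec_def abs_le_iff minus_le_iff)
  qed
  have PQ: "P = {q + c | q c. q \<in> Q \<and> c \<in> recession_cone J}"
  proof (intro subset_antisym subsetI)
    fix y assume "y \<in> P"
    then obtain q where "q \<in> P" "norm q \<le> R" "y - q \<in> recession_cone J" using R by blast
    then show "y \<in> {q + c | q c. q \<in> Q \<and> c \<in> recession_cone J}"
      using in_box by (intro CollectI exI[of _ q] exI[of _ "y - q"]) (auto simp: Q_def)
  qed (auto simp: Q_def J(2) solutions_add_recession_cone)
  have "box_integer Q"
    unfolding Q_def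
  proof (rule box_integer_Int_box[OF assms])
    have "P \<noteq> {}" using assms by (simp add: box_integer_def)
    then show "P \<inter> {-u..u} \<noteq> {}" using R in_box by blast
  qed (auto simp: u_def int_vectors_def)
  moreover have "bounded Q"
    by (simp add: Q_def bounded_Int interval_cbox_cart[symmetric])
  moreover have "box_integer (recession_cone J)"
    using box_integer_recession_cone assms J by blast
  ultimately show ?thesis
    using PQ cone_recession_cone by blast
qed

end
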